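(* Let $D$ be a regular $(v,k,\lambda,\mu)$-PDS in a finite group $G$ with $0<\mu<k$ and $\sqrt\Delta\in\mathbb{Z}$. Let $H$ be a nontrivial subgroup of the group of linear characters of $G$ all of whose elements have order coprime to $\sqrt\Delta$, and let $N=\bigcap_{\xi\in H}\ker\xi$. Then for every $a\in G\setminus N$ and every nonprincipal $\xi\in H$, \[|C_G(a)|\cdot|a^G\cap D|=k-\xi(D).\]
   Context: A $(v,k,\lambda,\mu)$-PDS in a group $G$ of order $v$ is a $k$-subset $D$ such that every nonidentity element of $D$ is $xy^{-1}$ ($x,y\in D$) in exactly $\lambda$ ways and every nonidentity element of $G\setminus D$ in exactly $\mu$ ways; regular means $D=D^{(-1)}$ and $1\notin D$. $\Delta=(\lambda-\mu)^2+4(k-\mu)$; $\chi(D)=\sum_{d\in D}\chi(d)$; $a^G$ is the conjugacy class of $a$. *)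

theory Defs
  imports "HOL-Algebra.Algebra" "HOL-Analysis.Analysis"
begin

definition is_PDS :: "('a, 'b) monoid_scheme \<Rightarrow> 'a set \<Rightarrow> nat \<Rightarrow> nat \<Rightarrow> nat \<Rightarrow> nat \<Rightarrow> bool" where
  "is_PDS G D v k lam mu \<longleftrightarrow>
     finite (carrier G) \<and> card (carrier G) = v \<and> D \<subseteq> carrier G \<and> card D = k \<and>
     (\<forall>g \<in> carrier G. g \<noteq> \<one>\<^bsub>G\<^esub> \<longrightarrow>
        card {(x, y). x \<in> D \<and> y \<in> D \<and> x \<otimes>\<^bsub>G\<^esub> inv\<^bsub>G\<^esub> y = g}
          = (if g \<in> D then lam else mu))"

definition is_regular_PDS :: "('a, 'b) monoid_scheme \<Rightarrow> 'a set \<Rightarrow> nat \<Rightarrow> nat \<Rightarrow> nat \<Rightarrow> nat \<Rightarrow> bool" where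
  "is_regular_PDS G D v k lam mu \<longleftrightarrow>
     is_PDS G D v k lam mu \<and> (\<lambda>x. inv\<^bsub>G\<^esub> x) ` D = D \<and> \<one>\<^bsub>G\<^esub> \<notin> D"

definition PDS_Delta :: "nat \<Rightarrow> nat \<Rightarrow> nat \<Rightarrow> int" where
  "PDS_Delta k lam mu = (int lam - int mu)^2 + 4 * (int k - int mu)"

definition linear_chars :: "('a, 'b) monoid_scheme \<Rightarrow> ('a \<Rightarrow> complex) set" where
  "linear_chars G = {c. c \<in> extensional (carrier G) \<and>
      (\<forall>x \<in> carrier G. c x \<noteq> 0) \<and>
      (\<forall>x \<in> carrier G. \<forall>y \<in> carrier G. c (x \<otimes>\<^bsub>G\<^esub> y) = c x * c y)}"

definition char_group :: "('a, 'b) monoid_scheme \<Rightarrow> ('a \<Rightarrow> complex) monoid" where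
  "char_group G = \<lparr> carrier = linear_chars G,
      monoid.mult = (\<lambda>c d. \<lambda>x \<in> carrier G. c x * d x),
      monoid.one = (\<lambda>x \<in> carrier G. 1) \<rparr>"

definition char_sum :: "('a \<Rightarrow> complex) \<Rightarrow> 'a set \<Rightarrow> complex" where
  "char_sum c D = (\<Sum>d \<in> D. c d)"

definition centralizer_elt :: "('a, 'b) monoid_scheme \<Rightarrow> 'a \<Rightarrow> 'a set" where
  "centralizer_elt G a = {g \<in> carrier G. g \<otimes>\<^bsub>G\<^esub> a = a \<otimes>\<^bsub>G\<^esub> g}"

definition conj_class :: "('a, 'b) monoid_scheme \<Rightarrow> 'a \<Rightarrow> 'a set" where
  "conj_class G a = {g \<otimes>\<^bsub>G\<^esub> a \<otimes>\<^bsub>G\<^esub> inv\<^bsub>G\<^esub> g | g. g \<in> carrier G}"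

end

(* Let Phi a = |C_G(a)| |a^G \<inter> D|, which counts the g with g a g^-1 \<in> D. In the group ring,
D^2 = (k - mu) + (lam - mu) D + mu G, so D has the eigenvalues k and theta, theta', where
theta - theta' = \<plusminus>s and (k - theta)(k - theta') = mu v. For a prime p not dividing s, one of the
factors, say k - theta, is divisible by the full p-part of v. Then
(D - theta - (k - theta)/v G) / (theta' - theta) is an idempotent with p-integral coefficients, and
the sum of its coefficients over a conjugacy class of p-singular elements vanishes (characters of
projective modules vanish on p-singular elements); this says Phi a = k - theta.

The vanishing is elementary: after clearing denominators, expand the p^n-th power of the
idempotent as a sum over words of length p^n and group the words by cyclic rotation. A word with
a small rotation orbit is a power of a short word, so its value is a high p-power in G; hence
large powers of p divide the sum for every n.

Every a outside N is detected by some character in H of p-power order with p not dividing s, which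
gives Phi a \<in> {k - theta, k - theta'}. As two proper subgroups do not cover G, Phi is constant,
say k - theta, outside N. Summing xi against Phi then gives xi(D) = theta. *)

theory Submission
  imports Defs
begin

section \<open>Orbit sums of a map of prime power period\<close>

text \<open>The orbit has as many points as the least period \<open>d\<close>, and \<open>d\<close>
  divides \<open>p ^ n\<close>, so \<open>d = p ^ i\<close>. If \<open>i \<le> m\<close>, then
  \<open>p ^ m\<close> would be a multiple of \<open>d\<close> and hence a period of
  \<open>w\<close>.\<close>

lemma periodic_orbit_card:
  fixes T :: "'b \<Rightarrow> 'b" and p m n :: nat
  assumes "Factorial_Ring.prime p" and per: "(T ^^ (p ^ n)) w = w" and nfix: "(T ^^ (p ^ m)) w \<noteq> w"
  shows "p ^ Suc m dvd card (range (\<lambda>i. (T ^^ i) w))"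
proof -
  define d where "d = (LEAST i. 0 < i \<and> (T ^^ i) w = w)"
  have "0 < p ^ n \<and> (T ^^ (p ^ n)) w = w"
    using assms prime_gt_0_nat by simp
  then have d: "0 < d" "(T ^^ d) w = w"
    unfolding d_def by (metis (mono_tags, lifting) LeastI)+
  have d_least: "d \<le> i" if "0 < i" "(T ^^ i) w = w" for i
    unfolding d_def using that by (simp add: Least_le)
  have mult: "(T ^^ (d * i)) w = w" for i
    by (induction i) (simp_all add: funpow_add d(2))
  have red: "(T ^^ i) w = (T ^^ (i mod d)) w" for i
    by (metis mult funpow_add comp_apply mod_mult_div_eq)
  have dvd: "d dvd i" if "(T ^^ i) w = w" for i
    by (metis d(1) d_least dvd_eq_mod_eq_0 linorder_not_le mod_less_divisor neq0_conv red that)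
  have "inj_on (\<lambda>i. (T ^^ i) w) {..<d}"
  proof (rule linorder_inj_onI')
    fix i j assume ij: "i \<in> {..<d}" "j \<in> {..<d}" "i < j"
    show "(T ^^ i) w \<noteq> (T ^^ j) w"
    proof
      assume eq: "(T ^^ i) w = (T ^^ j) w"
      have "(T ^^ (d - j + i)) w = (T ^^ (d - j)) ((T ^^ i) w)"
        by (simp add: funpow_add)
      also have "\<dots> = (T ^^ (d - j + j)) w"
        by (simp only: eq funpow_add comp_apply)
      also have "\<dots> = w" using ij d by simp
      finally have "d \<le> d - j + i" using ij by (intro d_least) auto
      with ij show False by auto
    qed
  qed
  moreover have "range (\<lambda>i. (T ^^ i) w) = (\<lambda>i. (T ^^ i) w) ` {..<d}"
  proof -
    have "(T ^^ i) w \<in> (\<lambda>i. (T ^^ i) w) ` {..<d}" for i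
      using red[of i] d(1) by (intro image_eqI[of _ _ "i mod d"]) auto
    then show ?thesis by auto
  qed
  ultimately have card: "card (range (\<lambda>i. (T ^^ i) w)) = d"
    by (simp add: card_image)
  obtain i where i: "d = p ^ i"
    using dvd[OF per] divides_primepow_nat[OF \<open>Factorial_Ring.prime p\<close>] by blast
  have "\<not> i \<le> m"
  proof
    assume "i \<le> m"
    then obtain e where "p ^ m = d * e" using i by (metis dvdE le_imp_power_dvd)
    with mult nfix show False by simp
  qed
  then have "Suc m \<le> i" by simp
  then show ?thesis unfolding card i by (rule le_imp_power_dvd)
qed

text \<open>\<open>W\<close> splits into orbits on which \<open>g\<close> is constant, so an orbit
  contributes its size times that constant. Either \<open>p ^ m\<close> steps fix the point and the
  constant is 0, or the size is divisible by \<open>p ^ Suc m\<close>.\<close>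

lemma prime_power_dvd_orbit_sum:
  fixes T :: "'b \<Rightarrow> 'b" and g :: "'b \<Rightarrow> int" and p m n :: nat
  assumes "finite W" "Factorial_Ring.prime p" and T: "\<And>w. w \<in> W \<Longrightarrow> T w \<in> W"
    and per: "\<And>w. w \<in> W \<Longrightarrow> (T ^^ (p ^ n)) w = w"
    and inv: "\<And>w. w \<in> W \<Longrightarrow> g (T w) = g w"
    and fix0: "\<And>w. w \<in> W \<Longrightarrow> (T ^^ (p ^ m)) w = w \<Longrightarrow> g w = 0"
  shows "int p ^ Suc m dvd sum g W"
proof -
  define orb where "orb = (\<lambda>w. range (\<lambda>i. (T ^^ i) w))"
  have TW: "(T ^^ i) w \<in> W" if "w \<in> W" for i w
    using that by (induction i) (auto intro: T)
  have gT: "g ((T ^^ i) w) = g w" if "w \<in> W" for i w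
    using that by (induction i) (simp_all add: inv TW)
  have self: "w \<in> orb w" for w
    unfolding orb_def by (metis funpow_0 rangeI)
  have sub: "orb x \<subseteq> orb w" if "x \<in> orb w" for x w
  proof -
    obtain i where "x = (T ^^ i) w" using \<open>x \<in> orb w\<close> unfolding orb_def by auto
    then have "(T ^^ j) x = (T ^^ (j + i)) w" for j by (simp add: funpow_add)
    then show ?thesis unfolding orb_def by auto
  qed
  have eq: "orb x = orb w" if w: "w \<in> W" and x: "x \<in> orb w" for x w
  proof -
    obtain i where i: "x = (T ^^ i) w" using x unfolding orb_def by auto
    have per': "(T ^^ (p ^ n * i)) w = w" for i
      by (induction i) (simp_all add: funpow_add per w)
    \<comment> \<open>The iterate \<open>p ^ n * i - i\<close>, a natural number by this inequality,
      leads from \<open>x\<close> back to \<open>w\<close>.\<close>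
    have "i \<le> p ^ n * i" using prime_gt_0_nat[OF \<open>Factorial_Ring.prime p\<close>] by simp
    then have "p ^ n * i = (p ^ n * i - i) + i" by simp
    then have "(T ^^ (p ^ n * i - i)) x = w"
      by (metis i per' funpow_add comp_apply)
    then have "w \<in> orb x" unfolding orb_def by auto
    with sub x show ?thesis by blast
  qed
  have "sum g W = (\<Sum>y\<in>orb ` W. sum g {x \<in> W. orb x = y})"
    using \<open>finite W\<close> by (rule sum.image_gen)
  also have "int p ^ Suc m dvd \<dots>"
  proof (rule dvd_sum)
    fix y assume "y \<in> orb ` W"
    then obtain w where w: "w \<in> W" "y = orb w" by (elim imageE)
    have "orb w \<subseteq> W" using TW w(1) unfolding orb_def by (intro image_subsetI)
    then have "{x \<in> W. orb x = y} = orb w"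
      unfolding w(2) using eq[OF w(1)] self by blast
    moreover have "sum g (orb w) = (\<Sum>x\<in>orb w. g w)"
      by (rule sum.cong) (auto simp: orb_def gT w)
    ultimately have "sum g {x \<in> W. orb x = y} = int (card (orb w)) * g w"
      by simp
    moreover have "int p ^ Suc m dvd int (card (orb w)) * g w"
    proof (cases "(T ^^ (p ^ m)) w = w")
      case True
      then show ?thesis using fix0 w by simp
    next
      case False
      then have "p ^ Suc m dvd card (orb w)"
        unfolding orb_def by (rule periodic_orbit_card[OF \<open>Factorial_Ring.prime p\<close> per[OF w(1)]])
      then have "int p ^ Suc m dvd int (card (orb w))"
        by (simp only: of_nat_power[symmetric] of_nat_dvd_iff)
      then show ?thesis by (rule dvd_mult2)
    qed
    ultimately show "int p ^ Suc m dvd sum g {x \<in> W. orb x = y}" by (simp only:)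
  qed
  finally show ?thesis .
qed

section \<open>Words fixed by a rotation\<close>

text \<open>For \<open>e > 0\<close> the list \<open>u\<close> is not longer than \<open>v\<close>,
  so it is a prefix of \<open>v\<close>. Cancelling it leaves a shorter list that still commutes
  with \<open>u\<close>.\<close>

lemma commuting_lists_replicate:
  assumes "u @ v = v @ u" "length v = length u * e"
  shows "v = concat (replicate e u)"
  using assms
proof (induction e arbitrary: v)
  case (Suc e)
  then have "length u \<le> length v" by simp
  then obtain v' where v': "v = u @ v'"
    using Suc.prems(1) by (metis append_eq_append_conv_if append_eq_conv_conj)
  with Suc show ?case by simp
qed simp

text \<open>Invariance under rotation by \<open>d\<close> says that the first \<open>d\<close>
  letters commute with the remaining ones.\<close>

lemma rotate_fixed_imp_concat:
  assumes "rotate d w = w" "length w = d * e"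
  shows "w = concat (replicate e (take d w))"
proof (cases "e = 0 \<or> d = 0")
  case True
  then show ?thesis using assms by auto
next
  case False
  then obtain e' where e': "e = Suc e'" by (cases e) auto
  then have le: "d \<le> length w" using assms by simp
  have "drop d w @ take d w = w"
  \<comment> \<open>Rotation takes \<open>d\<close> modulo the length, so a full turn needs its own
    case.\<close>
  proof (cases "d = length w")
    case False
    then show ?thesis using le assms(1) rotate_drop_take[of d w] by simp
  qed simp
  then have "take d w @ drop d w = drop d w @ take d w" by simp
  moreover have "length (drop d w) = length (take d w) * e'"
    using le assms(2) e' by simp
  ultimately have "drop d w = concat (replicate e' (take d w))"
    by (rule commuting_lists_replicate)
  then show ?thesis unfolding e' by (metis append_take_drop_id concat.simps(2) replicate_Suc)
qed

context group begin

section \<open>Powers of a group ring element as sums over words\<close>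

primrec word_prod :: "'a list \<Rightarrow> 'a" where
  "word_prod [] = \<one>"
| "word_prod (x # w) = x \<otimes> word_prod w"

definition words :: "nat \<Rightarrow> 'a list set" where
  "words n = {w. set w \<subseteq> carrier G \<and> length w = n}"

lemma word_prod_closed: "set w \<subseteq> carrier G \<Longrightarrow> word_prod w \<in> carrier G"
  by (induction w) auto

lemma word_prod_append:
  "set u \<subseteq> carrier G \<Longrightarrow> set w \<subseteq> carrier G \<Longrightarrow> word_prod (u @ w) = word_prod u \<otimes> word_prod w"
  by (induction u) (auto simp: word_prod_closed m_assoc)

lemma word_prod_concat_replicate:
  "set u \<subseteq> carrier G \<Longrightarrow> word_prod (concat (replicate e u)) = word_prod u [^] e"
proof (induction e)
  case (Suc e)
  have "set (concat (replicate e u)) \<subseteq> carrier G" using Suc.prems by (auto split: if_splits)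
  then show ?case using Suc nat_pow_Suc2[OF word_prod_closed[OF Suc.prems]]
    by (simp add: word_prod_append del: set_concat nat_pow_Suc)
qed simp

lemma sum_words_Suc:
  fixes f :: "'a \<Rightarrow> 'c::comm_semiring_1"
  shows "(\<Sum>w\<in>words (Suc n). prod_list (map f w) * \<phi> (word_prod w))
    = (\<Sum>h\<in>carrier G. f h * (\<Sum>w\<in>words n. prod_list (map f w) * \<phi> (h \<otimes> word_prod w)))"
proof -
  have "words (Suc n) = (\<lambda>(h, w). h # w) ` (carrier G \<times> words n)"
    by (auto simp: words_def length_Suc_conv image_iff)
  moreover have "inj_on (\<lambda>(h, w). h # w) (carrier G \<times> words n)" by (auto simp: inj_on_def)
  ultimately show ?thesis
    by (simp add: sum.reindex sum.cartesian_product sum_distrib_left mult.assoc case_prod_unfold)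
qed

text \<open>The left side pairs the \<open>Suc n\<close>-th convolution power of \<open>f\<close>
  with \<open>\<phi>\<close>, and \<open>f * f = M f\<close> reduces that power to
  \<open>M ^ n\<close> times \<open>f\<close>. The induction keeps \<open>\<phi>\<close> arbitrary
  because splitting off the first letter \<open>h\<close> replaces it by a translate.\<close>

lemma sum_words_idempotent:
  fixes f :: "'a \<Rightarrow> 'c::comm_semiring_1"
  assumes idem: "\<And>x. x \<in> carrier G \<Longrightarrow> (\<Sum>h\<in>carrier G. f h * f (inv h \<otimes> x)) = M * f x"
  shows "(\<Sum>w\<in>words (Suc n). prod_list (map f w) * \<phi> (word_prod w))
    = M ^ n * (\<Sum>x\<in>carrier G. f x * \<phi> x)"
proof (induction n arbitrary: \<phi>)
  case 0
  have "words 0 = {[]}" by (auto simp: words_def)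
  then show ?case by (simp add: sum_words_Suc)
next
  case (Suc n)
  have shift: "(\<Sum>x\<in>carrier G. f x * \<phi> (h \<otimes> x)) = (\<Sum>y\<in>carrier G. f (inv h \<otimes> y) * \<phi> y)"
    if h: "h \<in> carrier G" for h
    by (rule sum.reindex_bij_witness[of _ "\<lambda>y. inv h \<otimes> y" "\<lambda>x. h \<otimes> x"])
      (use h in \<open>auto simp: m_assoc[symmetric]\<close>)
  have "(\<Sum>w\<in>words (Suc (Suc n)). prod_list (map f w) * \<phi> (word_prod w))
    = (\<Sum>h\<in>carrier G. f h * (M ^ n * (\<Sum>x\<in>carrier G. f x * \<phi> (h \<otimes> x))))"
    using Suc.IH[of "\<lambda>x. \<phi> (h \<otimes> x)" for h] by (subst sum_words_Suc) simp
  also have "\<dots> = M ^ n * (\<Sum>h\<in>carrier G. \<Sum>y\<in>carrier G. f h * f (inv h \<otimes> y) * \<phi> y)"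
    by (simp add: shift sum_distrib_left mult_ac cong: sum.cong)
  also have "\<dots> = M ^ n * (\<Sum>y\<in>carrier G. (\<Sum>h\<in>carrier G. f h * f (inv h \<otimes> y)) * \<phi> y)"
    by (subst sum.swap) (simp add: sum_distrib_right)
  also have "\<dots> = M ^ Suc n * (\<Sum>y\<in>carrier G. f y * \<phi> y)"
    by (simp add: idem sum_distrib_left mult_ac cong: sum.cong)
  finally show ?case .
qed

text \<open>This is the elementary form of the vanishing on p-singular classes: \<open>f / M\<close>
  is the idempotent and \<open>\<phi>\<close> a class function that is zero on all
  \<open>p ^ j\<close>-th powers. The sum turns out to be divisible by every power of
  \<open>p\<close>.\<close>

lemma idempotent_class_sum_eq_0:
  fixes f \<phi> :: "'a \<Rightarrow> int" and p j :: nat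
  assumes fin: "finite (carrier G)" and p: "Factorial_Ring.prime p" "\<not> int p dvd M"
    and idem: "\<And>x. x \<in> carrier G \<Longrightarrow> (\<Sum>h\<in>carrier G. f h * f (inv h \<otimes> x)) = M * f x"
    and class_fun: "\<And>x y. x \<in> carrier G \<Longrightarrow> y \<in> carrier G \<Longrightarrow> \<phi> (x \<otimes> y) = \<phi> (y \<otimes> x)"
    and pow0: "\<And>x. x \<in> carrier G \<Longrightarrow> \<phi> (x [^] (p ^ j)) = 0"
  shows "(\<Sum>x\<in>carrier G. f x * \<phi> x) = 0"
proof -
  define t where "t = (\<Sum>x\<in>carrier G. f x * \<phi> x)"
  define g where "g = (\<lambda>w. prod_list (map f w) * \<phi> (word_prod w))"
  have dvd: "int p ^ Suc m dvd t" for m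
  proof -
    \<comment> \<open>With this length, a word fixed by rotation through \<open>p ^ m\<close> places
      consists of \<open>p ^ j\<close> copies of its initial segment, so its product is a
      \<open>p ^ j\<close>-th power and \<open>\<phi>\<close> kills it.\<close>
    define n where "n = m + j"
    have inv: "g (rotate1 w) = g w" if "w \<in> words (p ^ n)" for w
    proof (cases w)
      case (Cons x u)
      then have "x \<in> carrier G" "set u \<subseteq> carrier G" using that by (auto simp: words_def)
      then show ?thesis
        using class_fun[of x "word_prod u"]
        by (simp add: g_def Cons word_prod_append word_prod_closed)
    qed simp
    have fix0: "g w = 0" if w: "w \<in> words (p ^ n)" and "(rotate1 ^^ (p ^ m)) w = w" for w
    proof -
      have "w = concat (replicate (p ^ j) (take (p ^ m) w))"
        using that unfolding n_def words_def rotate_def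
        by (intro rotate_fixed_imp_concat) (auto simp: rotate_def power_add)
      moreover have sub: "set (take (p ^ m) w) \<subseteq> carrier G"
        using w set_take_subset unfolding words_def by fastforce
      ultimately have "word_prod w = word_prod (take (p ^ m) w) [^] (p ^ j)"
        by (metis word_prod_concat_replicate)
      then show ?thesis unfolding g_def using pow0 word_prod_closed[OF sub] by simp
    qed
    have per: "(rotate1 ^^ (p ^ n)) w = w" if "w \<in> words (p ^ n)" for w
    proof -
      have "length w = p ^ n" using that by (simp add: words_def)
      then show ?thesis by (metis rotate_def rotate_id mod_self)
    qed
    have "finite (words (p ^ n))"
      unfolding words_def using fin by (rule finite_lists_length_eq)
    then have "int p ^ Suc m dvd sum g (words (p ^ n))"
      using p(1) per inv fix0
      by (intro prime_power_dvd_orbit_sum[where T = rotate1 and n = n]) (auto simp: words_def)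
    also have "sum g (words (p ^ n)) = M ^ (p ^ n - 1) * t"
      using sum_words_idempotent[OF idem, where n = "p ^ n - 1" and \<phi> = \<phi>] prime_gt_0_nat[OF p(1)]
      unfolding g_def t_def by simp
    finally have *: "int p ^ Suc m dvd M ^ (p ^ n - 1) * t" .
    have "coprime (int p) M" using p by (simp add: prime_imp_coprime)
    then have "coprime (int p ^ Suc m) (M ^ (p ^ n - 1))"
      by (simp only: coprime_power_left_iff coprime_power_right_iff) auto
    with * show ?thesis by (simp only: coprime_dvd_mult_right_iff)
  qed
  have "t = 0"
  proof (rule ccontr)
    assume "t \<noteq> 0"
    \<comment> \<open>For \<open>m = \<bar>t\<bar>\<close> the divisor \<open>p ^ Suc m\<close>
      already exceeds \<open>\<bar>t\<bar>\<close>.\<close>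
    define m where "m = nat \<bar>t\<bar>"
    have "m < p ^ m" using power_gt_expt[of p m] prime_gt_1_nat[OF p(1)] by simp
    moreover have "p ^ m \<le> p ^ Suc m" using prime_gt_0_nat[OF p(1)] by simp
    ultimately have "m < p ^ Suc m" by (rule less_le_trans)
    then have "int m < int p ^ Suc m" by (simp only: of_nat_power[symmetric] of_nat_less_iff)
    moreover have "int p ^ Suc m \<le> \<bar>t\<bar>"
      using dvd_imp_le_int[OF \<open>t \<noteq> 0\<close> dvd[of m]] by simp
    ultimately show False unfolding m_def by simp
  qed
  then show ?thesis unfolding t_def .
qed

section \<open>Translation and conjugation counts\<close>

lemma sum_left_translate:
  assumes "h \<in> carrier G"
  shows "(\<Sum>x\<in>carrier G. f (inv h \<otimes> x)) = (\<Sum>x\<in>carrier G. f x)"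
  by (rule sum.reindex_bij_witness[of _ "\<lambda>y. h \<otimes> y" "\<lambda>x. inv h \<otimes> x"])
    (use assms in \<open>auto simp: m_assoc[symmetric]\<close>)

text \<open>The fibre of \<open>g \<mapsto> g a g^-1\<close> through \<open>g\<close> is the coset
  of the centralizer that contains \<open>g\<close>, so all nonempty fibres have the same size.
  Taking \<open>E = D\<close> gives the count of the theorem, and \<open>E = carrier G\<close> gives
  the orbit-stabilizer formula.\<close>

lemma card_conjugators:
  assumes fin: "finite (carrier G)" and a: "a \<in> carrier G"
  shows "card {g \<in> carrier G. g \<otimes> a \<otimes> inv g \<in> E}
    = card (centralizer_elt G a) * card (conj_class G a \<inter> E)"
proof -
  define S where "S = {g \<in> carrier G. g \<otimes> a \<otimes> inv g \<in> E}"
  define c where "c = (\<lambda>g. g \<otimes> a \<otimes> inv g)"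
  have fibre: "card {x \<in> S. c x = y} = card (centralizer_elt G a)" if "y \<in> c ` S" for y
  proof -
    obtain g where g: "g \<in> carrier G" "c g = y" "y \<in> E"
      using \<open>y \<in> c ` S\<close> unfolding S_def c_def by auto
    have comm: "c x = c g \<longleftrightarrow> (inv g \<otimes> x) \<otimes> a = a \<otimes> (inv g \<otimes> x)" if x: "x \<in> carrier G" for x
    proof -
      have "c x = c g \<longleftrightarrow> x \<otimes> a = c g \<otimes> x"
        unfolding c_def using a g x
        by (metis inv_closed inv_solve_right' m_closed)
      also have "\<dots> \<longleftrightarrow> x \<otimes> a = g \<otimes> (a \<otimes> (inv g \<otimes> x))"
        unfolding c_def using a g x by (simp add: m_assoc)
      also have "\<dots> \<longleftrightarrow> inv g \<otimes> (x \<otimes> a) = a \<otimes> (inv g \<otimes> x)"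
        using a g x by (metis inv_closed inv_solve_left m_closed)
      also have "\<dots> \<longleftrightarrow> (inv g \<otimes> x) \<otimes> a = a \<otimes> (inv g \<otimes> x)"
        using a g x by (simp add: m_assoc)
      finally show ?thesis .
    qed
    have "bij_betw (\<lambda>x. inv g \<otimes> x) {x \<in> S. c x = y} (centralizer_elt G a)"
    proof (rule bij_betw_byWitness[where f' = "\<lambda>z. g \<otimes> z"])
      show "(\<lambda>x. inv g \<otimes> x) ` {x \<in> S. c x = y} \<subseteq> centralizer_elt G a"
        using comm g unfolding S_def centralizer_elt_def by auto
      show "(\<lambda>z. g \<otimes> z) ` centralizer_elt G a \<subseteq> {x \<in> S. c x = y}"
      proof (rule image_subsetI)
        fix z assume z: "z \<in> centralizer_elt G a"
        then have zc: "z \<in> carrier G" "z \<otimes> a = a \<otimes> z" unfolding centralizer_elt_def by auto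
        have "inv g \<otimes> (g \<otimes> z) = z" using g zc by (simp add: m_assoc[symmetric])
        then have "c (g \<otimes> z) = c g" using comm[of "g \<otimes> z"] g zc by simp
        then show "g \<otimes> z \<in> {x \<in> S. c x = y}" using g zc unfolding S_def c_def by simp
      qed
    qed (use g in \<open>auto simp: S_def centralizer_elt_def m_assoc[symmetric]\<close>)
    then show ?thesis by (rule bij_betw_same_card)
  qed
  have "card S = (\<Sum>x\<in>S. 1)" by simp
  also have "\<dots> = (\<Sum>y\<in>c ` S. \<Sum>x | x \<in> S \<and> c x = y. 1)"
    using fin unfolding S_def by (intro sum.image_gen) simp
  also have "\<dots> = (\<Sum>y\<in>c ` S. card (centralizer_elt G a))"
    using fibre by (intro sum.cong) auto
  also have "\<dots> = card (centralizer_elt G a) * card (c ` S)" by simp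
  also have "c ` S = conj_class G a \<inter> E" unfolding c_def S_def conj_class_def by auto
  finally show ?thesis unfolding S_def .
qed

section \<open>The group ring identity of a regular PDS\<close>

text \<open>This is the coefficient at \<open>g\<close> of the identity for D^2. As \<open>D\<close>
  is closed under inverses, a factorization \<open>g = h (h^-1 g)\<close> within \<open>D\<close> is
  the same as a quotient \<open>x y^-1\<close> with \<open>x = h\<close> and
  \<open>y = g^-1 h\<close>; for \<open>g = \<one>\<close> there are \<open>k\<close> of
  them.\<close>

lemma regular_PDS_convolution:
  assumes D: "is_regular_PDS G D v k lam mu" and g: "g \<in> carrier G"
  shows "(\<Sum>h\<in>carrier G. of_bool (h \<in> D) * of_bool (inv h \<otimes> g \<in> D) :: int)
    = (int k - int mu) * of_bool (g = \<one>) + (int lam - int mu) * of_bool (g \<in> D) + int mu"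
proof -
  note defs = D[unfolded is_regular_PDS_def is_PDS_def]
  have sub: "D \<subseteq> carrier G" and fin: "finite (carrier G)" and "\<one> \<notin> D" and inv_im: "(\<lambda>x. inv x) ` D = D"
    using defs by auto
  have inv_D: "inv x \<in> D" if "x \<in> D" for x using inv_im that by blast
  have "(\<Sum>h\<in>carrier G. of_bool (h \<in> D) * of_bool (inv h \<otimes> g \<in> D) :: int)
    = (\<Sum>h\<in>carrier G. of_bool (h \<in> D \<and> inv h \<otimes> g \<in> D))"
    by (rule sum.cong) auto
  also have "\<dots> = int (card {h \<in> carrier G. h \<in> D \<and> inv h \<otimes> g \<in> D})"
    using fin by (simp add: Int_def)
  also have "{h \<in> carrier G. h \<in> D \<and> inv h \<otimes> g \<in> D} = {h \<in> D. inv h \<otimes> g \<in> D}"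
    using sub by auto
  finally have eq: "(\<Sum>h\<in>carrier G. of_bool (h \<in> D) * of_bool (inv h \<otimes> g \<in> D) :: int)
    = int (card {h \<in> D. inv h \<otimes> g \<in> D})" .
  show ?thesis
  proof (cases "g = \<one>")
    case True
    have "{h \<in> D. inv h \<otimes> g \<in> D} = D" using True sub inv_D by auto
    then show ?thesis unfolding eq using True \<open>\<one> \<notin> D\<close> defs by simp
  next
    case False
    have "bij_betw (\<lambda>h. (h, inv g \<otimes> h)) {h \<in> D. inv h \<otimes> g \<in> D}
        {(x, y). x \<in> D \<and> y \<in> D \<and> x \<otimes> inv y = g}"
    proof (rule bij_betw_byWitness[where f' = fst])
      show "(\<lambda>h. (h, inv g \<otimes> h)) ` {h \<in> D. inv h \<otimes> g \<in> D}
        \<subseteq> {(x, y). x \<in> D \<and> y \<in> D \<and> x \<otimes> inv y = g}"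
      proof (rule image_subsetI)
        fix h assume h: "h \<in> {h \<in> D. inv h \<otimes> g \<in> D}"
        then have hc: "h \<in> carrier G" using sub by auto
        have "inv (inv h \<otimes> g) = inv g \<otimes> h" using hc g by (simp add: inv_mult_group)
        then have "inv g \<otimes> h \<in> D" using h inv_D by fastforce
        moreover have "h \<otimes> inv (inv g \<otimes> h) = g"
          using hc g by (simp add: inv_mult_group m_assoc[symmetric])
        ultimately show "(h, inv g \<otimes> h) \<in> {(x, y). x \<in> D \<and> y \<in> D \<and> x \<otimes> inv y = g}"
          using h by simp
      qed
      have *: "inv g \<otimes> x = y" "inv x \<otimes> g = inv y" if "x \<in> D" "y \<in> D" "x \<otimes> inv y = g" for x y
      proof -
        have c: "x \<in> carrier G" "y \<in> carrier G" using that sub by auto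
        show "inv g \<otimes> x = y" using c that(3)[symmetric] by (simp add: inv_mult_group m_assoc)
        show "inv x \<otimes> g = inv y" using c that(3)[symmetric] by (simp add: m_assoc[symmetric])
      qed
      show "\<forall>xy\<in>{(x, y). x \<in> D \<and> y \<in> D \<and> x \<otimes> inv y = g}. (fst xy, inv g \<otimes> fst xy) = xy"
        using *(1) by auto
      show "fst ` {(x, y). x \<in> D \<and> y \<in> D \<and> x \<otimes> inv y = g} \<subseteq> {h \<in> D. inv h \<otimes> g \<in> D}"
        using *(2) inv_D by auto
    qed simp
    then have "card {h \<in> D. inv h \<otimes> g \<in> D} = (if g \<in> D then lam else mu)"
      using defs g False by (metis (no_types, lifting) bij_betw_same_card)
    then show ?thesis unfolding eq using False by simp
  qed
qed

text \<open>Sum the coefficients on both sides of the identity for D^2.\<close>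

lemma regular_PDS_card_identity:
  assumes D: "is_regular_PDS G D v k lam mu"
  shows "int k * int k = (int k - int mu) + (int lam - int mu) * int k + int mu * int v"
proof -
  note defs = D[unfolded is_regular_PDS_def is_PDS_def]
  have fin: "finite (carrier G)" using defs by blast
  have sumD: "(\<Sum>x\<in>carrier G. of_bool (x \<in> D)) = int k"
    using fin defs by (simp add: Int_absorb1 Int_absorb2)
  have "int k * int k = (\<Sum>h\<in>carrier G. of_bool (h \<in> D) * (\<Sum>g\<in>carrier G. of_bool (inv h \<otimes> g \<in> D)))"
    using sum_left_translate[where f = "\<lambda>x. of_bool (x \<in> D) :: int"]
    by (simp add: sumD sum_distrib_right[symmetric] del: sum_of_bool_eq)
  also have "\<dots> = (\<Sum>g\<in>carrier G. \<Sum>h\<in>carrier G. of_bool (h \<in> D) * of_bool (inv h \<otimes> g \<in> D))"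
    by (subst sum.swap) (simp only: sum_distrib_left)
  also have "\<dots> = (\<Sum>g\<in>carrier G. (int k - int mu) * of_bool (g = \<one>)
      + (int lam - int mu) * of_bool (g \<in> D) + int mu)"
    by (rule sum.cong[OF refl]) (rule regular_PDS_convolution[OF D])
  also have "\<dots> = (int k - int mu) * (\<Sum>g\<in>carrier G. of_bool (g = \<one>))
      + (int lam - int mu) * (\<Sum>g\<in>carrier G. of_bool (g \<in> D)) + int mu * int v"
    using defs by (simp add: sum.distrib sum_distrib_left del: sum_of_bool_eq)
  also have "(\<Sum>g\<in>carrier G. of_bool (g = \<one>)) = (1::int)"
  proof -
    have "carrier G \<inter> {g. g = \<one>} = {\<one>}" by auto
    then show ?thesis using fin by simp
  qed
  finally show ?thesis unfolding sumD by simp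
qed

text \<open>The square of \<open>\<alpha> D + \<beta> 1 + \<gamma> G\<close> in the group ring,
  obtained from the identity for D^2 together with D G = G D = k G and G^2 = v G.\<close>

lemma regular_PDS_affine_convolution:
  fixes \<alpha> \<beta> \<gamma> :: int
  assumes D: "is_regular_PDS G D v k lam mu" and x: "x \<in> carrier G"
  defines "f \<equiv> \<lambda>x. \<alpha> * of_bool (x \<in> D) + \<beta> * of_bool (x = \<one>) + \<gamma>"
  shows "(\<Sum>h\<in>carrier G. f h * f (inv h \<otimes> x))
    = (\<alpha>\<^sup>2 * (int lam - int mu) + 2 * \<alpha> * \<beta>) * of_bool (x \<in> D)
      + (\<alpha>\<^sup>2 * (int k - int mu) + \<beta>\<^sup>2) * of_bool (x = \<one>)
      + (\<alpha>\<^sup>2 * int mu + 2 * \<alpha> * \<gamma> * int k + 2 * \<beta> * \<gamma> + \<gamma>\<^sup>2 * int v)"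
proof -
  note defs = D[unfolded is_regular_PDS_def is_PDS_def]
  have fin: "finite (carrier G)" and card: "card (carrier G) = v" using defs by blast+
  define d :: "'a \<Rightarrow> int" where "d = (\<lambda>x. of_bool (x \<in> D))"
  define e :: "'a \<Rightarrow> int" where "e = (\<lambda>x. of_bool (x = \<one>))"
  have f: "f h = \<alpha> * d h + \<beta> * e h + \<gamma>" for h by (simp only: f_def d_def e_def)
  have sd: "(\<Sum>h\<in>carrier G. d h) = int k"
    using fin defs by (simp add: d_def Int_absorb1 Int_absorb2)
  have cancel: "x \<otimes> (inv x \<otimes> h) = h" if "h \<in> carrier G" for h
    using x that by (simp add: m_assoc[symmetric])
  \<comment> \<open>The map \<open>h \<mapsto> h^-1 x\<close> permutes the group; this evaluates the
    products with G on the left.\<close>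
  have flip: "(\<Sum>h\<in>carrier G. \<psi> (inv h \<otimes> x)) = (\<Sum>h\<in>carrier G. \<psi> h)" for \<psi> :: "'a \<Rightarrow> int"
    by (rule sum.reindex_bij_witness[of _ "\<lambda>y. x \<otimes> inv y" "\<lambda>h. inv h \<otimes> x"])
      (use x in \<open>auto simp: m_assoc inv_mult_group cancel\<close>)
  have e_left: "(\<Sum>h\<in>carrier G. e h * \<psi> h) = \<psi> \<one>" for \<psi> :: "'a \<Rightarrow> int"
  proof -
    have "(\<Sum>h\<in>carrier G. e h * \<psi> h) = (\<Sum>h\<in>carrier G. if h = \<one> then \<psi> h else 0)"
      by (rule sum.cong) (auto simp: e_def)
    then show ?thesis using fin by simp
  qed
  have e_right: "(\<Sum>h\<in>carrier G. \<psi> h * e (inv h \<otimes> x)) = \<psi> x" for \<psi> :: "'a \<Rightarrow> int"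
  proof -
    have "(\<Sum>h\<in>carrier G. \<psi> h * e (inv h \<otimes> x)) = (\<Sum>h\<in>carrier G. if h = x then \<psi> h else 0)"
    proof (rule sum.cong)
      fix h assume h: "h \<in> carrier G"
      then have "inv h \<otimes> x = \<one> \<longleftrightarrow> h = x"
        using x by (metis inv_closed inv_equality inv_inv l_inv)
      then show "\<psi> h * e (inv h \<otimes> x) = (if h = x then \<psi> h else 0)" by (simp add: e_def)
    qed simp
    then show ?thesis using fin x by simp
  qed
  have dd: "(\<Sum>h\<in>carrier G. d h * d (inv h \<otimes> x))
      = (int k - int mu) * e x + (int lam - int mu) * d x + int mu"
    unfolding d_def e_def by (rule regular_PDS_convolution[OF D x])
  have se: "(\<Sum>h\<in>carrier G. e h) = 1" using e_left[of "\<lambda>_. 1"] by simp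
  have "f h * f (inv h \<otimes> x) = \<alpha>\<^sup>2 * (d h * d (inv h \<otimes> x)) + \<alpha> * \<beta> * (d h * e (inv h \<otimes> x))
      + \<alpha> * \<beta> * (e h * d (inv h \<otimes> x)) + \<beta>\<^sup>2 * (e h * e (inv h \<otimes> x))
      + \<alpha> * \<gamma> * d h + \<alpha> * \<gamma> * d (inv h \<otimes> x) + \<beta> * \<gamma> * e h + \<beta> * \<gamma> * e (inv h \<otimes> x) + \<gamma>\<^sup>2" for h
    unfolding f by (simp add: algebra_simps power2_eq_square)
  then have "(\<Sum>h\<in>carrier G. f h * f (inv h \<otimes> x))
    = \<alpha>\<^sup>2 * (\<Sum>h\<in>carrier G. d h * d (inv h \<otimes> x)) + \<alpha> * \<beta> * (\<Sum>h\<in>carrier G. d h * e (inv h \<otimes> x))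
      + \<alpha> * \<beta> * (\<Sum>h\<in>carrier G. e h * d (inv h \<otimes> x)) + \<beta>\<^sup>2 * (\<Sum>h\<in>carrier G. e h * e (inv h \<otimes> x))
      + \<alpha> * \<gamma> * (\<Sum>h\<in>carrier G. d h) + \<alpha> * \<gamma> * (\<Sum>h\<in>carrier G. d (inv h \<otimes> x))
      + \<beta> * \<gamma> * (\<Sum>h\<in>carrier G. e h) + \<beta> * \<gamma> * (\<Sum>h\<in>carrier G. e (inv h \<otimes> x)) + \<gamma>\<^sup>2 * int v"
    by (simp only: sum.distrib sum_distrib_left) (simp add: card)
  also have "\<dots> = \<alpha>\<^sup>2 * ((int k - int mu) * e x + (int lam - int mu) * d x + int mu)
      + \<alpha> * \<beta> * d x + \<alpha> * \<beta> * d x + \<beta>\<^sup>2 * e x + \<alpha> * \<gamma> * int k + \<alpha> * \<gamma> * int k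
      + \<beta> * \<gamma> + \<beta> * \<gamma> + \<gamma>\<^sup>2 * int v"
    using x by (simp only: dd e_right e_left flip sd se) simp
  also have "\<dots> = (\<alpha>\<^sup>2 * (int lam - int mu) + 2 * \<alpha> * \<beta>) * d x
      + (\<alpha>\<^sup>2 * (int k - int mu) + \<beta>\<^sup>2) * e x
      + (\<alpha>\<^sup>2 * int mu + 2 * \<alpha> * \<gamma> * int k + 2 * \<beta> * \<gamma> + \<gamma>\<^sup>2 * int v)"
    by (simp add: algebra_simps)
  finally show ?thesis unfolding d_def e_def .
qed

section \<open>The count on a class without high p-powers\<close>

text \<open>\<open>y x\<close> is the conjugate of \<open>x y\<close> by \<open>y\<close>; thus the
  indicator of a class is a class function in the sense of
  \<open>idempotent_class_sum_eq_0\<close>.\<close>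

lemma conj_class_mult_commute:
  assumes "a \<in> carrier G" "x \<in> carrier G" "y \<in> carrier G"
  shows "x \<otimes> y \<in> conj_class G a \<longleftrightarrow> y \<otimes> x \<in> conj_class G a"
proof -
  have imp: "y \<otimes> x \<in> conj_class G a"
    if xy: "x \<otimes> y \<in> conj_class G a" "x \<in> carrier G" "y \<in> carrier G" for x y
  proof -
    obtain g where g: "g \<in> carrier G" "x \<otimes> y = g \<otimes> a \<otimes> inv g"
      using xy unfolding conj_class_def by auto
    have "y \<otimes> x = y \<otimes> (x \<otimes> y) \<otimes> inv y" using xy by (simp add: m_assoc)
    also have "\<dots> = (y \<otimes> g) \<otimes> a \<otimes> inv (y \<otimes> g)"
      using xy g assms by (simp add: g(2) inv_mult_group m_assoc)
    finally show ?thesis using xy g unfolding conj_class_def by blast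
  qed
  show ?thesis using imp assms by blast
qed

text \<open>Here \<open>p ^ r\<close> is the full p-part of \<open>v\<close>, so
  \<open>(k - \<theta>) / v = u / v'\<close> has a denominator prime to \<open>p\<close>, and
  multiplying by \<open>v'\<close> makes the idempotent integral. The vanishing lemma, applied to
  the indicator of the class \<open>C\<close>, gives \<open>v' |C \<inter> D| = |C| u\<close>; the
  centralizer order then turns \<open>|C|\<close> into \<open>v\<close>.\<close>

lemma regular_PDS_conj_count:
  fixes \<theta> \<theta>' :: int and p j r :: nat
  assumes D: "is_regular_PDS G D v k lam mu"
    and roots: "\<theta> + \<theta>' = int lam - int mu" "\<theta> * \<theta>' = int mu - int k"
    and p: "Factorial_Ring.prime p" "\<not> int p dvd \<theta>' - \<theta>"
    and dvd: "v = p ^ r * v'" "\<not> p dvd v'" "int k - \<theta> = int p ^ r * u"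
    and a: "a \<in> carrier G" and nopow: "\<And>x. x \<in> carrier G \<Longrightarrow> x [^] (p ^ j) \<notin> conj_class G a"
  shows "int (card (centralizer_elt G a) * card (conj_class G a \<inter> D)) = int k - \<theta>"
proof -
  note defs = D[unfolded is_regular_PDS_def is_PDS_def]
  have fin: "finite (carrier G)" using defs by blast
  define C where "C = conj_class G a"
  have C: "C \<subseteq> carrier G" unfolding C_def conj_class_def using a by auto
  have one: "\<one> \<notin> C" using nopow[of \<one>] unfolding C_def by simp
  \<comment> \<open>\<open>f / M\<close> is the idempotent \<open>(D - \<theta> - (k - \<theta>) / v G) / (\<theta>' - \<theta>)\<close>.\<close>
  define f where "f = (\<lambda>x. int v' * of_bool (x \<in> D) + (- int v' * \<theta>) * of_bool (x = \<one>) + - u)"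
  define M where "M = int v' * (\<theta>' - \<theta>)"
  have p_pos: "int p ^ r \<noteq> 0" using prime_gt_0_nat[OF p(1)] by simp
  \<comment> \<open>Both sides equal mu v = (k - \<theta>)(k - \<theta>'), the counting identity in
    terms of the eigenvalues.\<close>
  have "int p ^ r * (int v' * int mu) = int p ^ r * (u * (int k - \<theta>'))"
  proof -
    have "int p ^ r * (int v' * int mu) = int mu * int v" by (simp add: dvd(1))
    also have "\<dots> = int k * int k - (int k - int mu) - (int lam - int mu) * int k"
      using regular_PDS_card_identity[OF D] by simp
    also have "\<dots> = (int k - \<theta>) * (int k - \<theta>')"
      unfolding roots(1)[symmetric] using roots(2) by (simp add: algebra_simps)
    finally show ?thesis by (simp add: dvd(3))
  qed
  then have v'mu: "int v' * int mu = u * (int k - \<theta>')"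
    unfolding mult_left_cancel[OF p_pos] .
  have uv: "u * int v = int v' * (int k - \<theta>)" by (simp add: dvd)
  have idem: "(\<Sum>h\<in>carrier G. f h * f (inv h \<otimes> x)) = M * f x" if x: "x \<in> carrier G" for x
  proof -
    have k_mu: "int k - int mu = - (\<theta> * \<theta>')" using roots(2) by simp
    \<comment> \<open>The coefficient of G is arranged so that \<open>v'mu\<close> and
      \<open>uv\<close> apply: it becomes v' u times (k - \<theta>') - 2 (k - \<theta>) + (k -
      \<theta>) = \<theta> - \<theta>'.\<close>
    have "(int v')\<^sup>2 * int mu + 2 * int v' * (- u) * int k + 2 * (- int v' * \<theta>) * (- u) + (- u)\<^sup>2 * int v
      = int v' * (int v' * int mu) - 2 * (int v' * u) * (int k - \<theta>) + u * (u * int v)"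
      by (simp add: algebra_simps power2_eq_square)
    also have "\<dots> = M * (- u)"
      unfolding v'mu uv M_def by (simp add: algebra_simps)
    finally have const: "(int v')\<^sup>2 * int mu + 2 * int v' * (- u) * int k + 2 * (- int v' * \<theta>) * (- u)
      + (- u)\<^sup>2 * int v = M * (- u)" .
    have D_coeff: "(int v')\<^sup>2 * (int lam - int mu) + 2 * int v' * (- int v' * \<theta>) = M * int v'"
      unfolding roots(1)[symmetric] M_def by (simp add: algebra_simps power2_eq_square)
    have one_coeff: "(int v')\<^sup>2 * (int k - int mu) + (- int v' * \<theta>)\<^sup>2 = M * (- int v' * \<theta>)"
      unfolding k_mu M_def by (simp add: algebra_simps power2_eq_square)
    show ?thesis
      unfolding f_def regular_PDS_affine_convolution[OF D x] const D_coeff one_coeff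
      by (simp only: distrib_left mult.assoc)
  qed
  have ndvd: "\<not> int p dvd M"
    using p dvd(2) unfolding M_def by (simp add: prime_dvd_mult_iff)
  have "(\<Sum>x\<in>carrier G. f x * of_bool (x \<in> C)) = 0"
    using fin p(1) ndvd idem
  proof (rule idempotent_class_sum_eq_0)
    show "of_bool (x \<otimes> y \<in> C) = of_bool (y \<otimes> x \<in> C)" if "x \<in> carrier G" "y \<in> carrier G" for x y
      using conj_class_mult_commute[OF a that] unfolding C_def by simp
    show "of_bool (x [^] (p ^ j) \<in> C) = 0" if "x \<in> carrier G" for x
      using nopow[OF that] unfolding C_def by simp
  qed
  also have "(\<Sum>x\<in>carrier G. f x * of_bool (x \<in> C)) = (\<Sum>x\<in>C. f x)"
    using C fin by (intro sum.mono_neutral_cong_right) auto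
  \<comment> \<open>The term with \<open>\<theta>\<close> sits at the identity, which is a
    \<open>p ^ j\<close>-th power and so lies outside \<open>C\<close>.\<close>
  also have "\<dots> = (\<Sum>x\<in>C. int v' * of_bool (x \<in> D) - u)"
    using one unfolding f_def by (intro sum.cong) auto
  also have "\<dots> = int v' * int (card (C \<inter> D)) - int (card C) * u"
    using finite_subset[OF C fin] by (simp add: sum_subtractf sum_distrib_left[symmetric])
  finally have eq: "int v' * int (card (C \<inter> D)) = int (card C) * u" by simp
  have vC: "int v = int (card (centralizer_elt G a)) * int (card C)"
  proof -
    have "{g \<in> carrier G. g \<otimes> a \<otimes> inv g \<in> carrier G} = carrier G" using a by auto
    then show ?thesis using card_conjugators[OF fin a, of "carrier G"] C defs
      unfolding C_def by (simp add: Int_absorb2)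
  qed
  have "int v' * (int (card (centralizer_elt G a)) * int (card (C \<inter> D))) = int (card (centralizer_elt G a)) * (int v' * int (card (C \<inter> D)))"
    by (simp add: mult_ac)
  also have "\<dots> = u * int v" unfolding eq vC by (simp add: mult_ac)
  finally have "int v' * (int (card (centralizer_elt G a)) * int (card (C \<inter> D))) = int v' * (int k - \<theta>)"
    unfolding uv .
  moreover have "v' \<noteq> 0" using dvd(2) by (metis dvd_0_right)
  ultimately show ?thesis unfolding C_def by simp
qed

section \<open>Linear characters\<close>

lemma linear_char_one:
  assumes "c \<in> linear_chars G"
  shows "c \<one> = 1"
proof -
  have "c (\<one> \<otimes> \<one>) = c \<one> * c \<one>" "c \<one> \<noteq> 0" using assms unfolding linear_chars_def by blast+
  then show ?thesis by simp
qed

lemma linear_char_mult: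
  "c \<in> linear_chars G \<Longrightarrow> x \<in> carrier G \<Longrightarrow> y \<in> carrier G \<Longrightarrow> c (x \<otimes> y) = c x * c y"
  unfolding linear_chars_def by blast

lemma linear_char_pow:
  assumes "c \<in> linear_chars G" "x \<in> carrier G"
  shows "c (x [^] (n::nat)) = c x ^ n"
  using assms by (induction n) (simp_all add: linear_char_one linear_char_mult)

lemma linear_char_conj:
  assumes c: "c \<in> linear_chars G" and "g \<in> carrier G" "x \<in> carrier G"
  shows "c (g \<otimes> x \<otimes> inv g) = c x"
proof -
  have "c g * c (inv g) = 1"
    using linear_char_mult[OF c, of g "inv g"] linear_char_one[OF c] assms by simp
  then show ?thesis using assms by (simp add: linear_char_mult)
qed

text \<open>Translating the sum by \<open>g\<close> multiplies it by \<open>c g\<close>, which is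
  not 1.\<close>

lemma sum_linear_char:
  assumes c: "c \<in> linear_chars G" and g: "g \<in> carrier G" "c g \<noteq> 1"
  shows "(\<Sum>x\<in>carrier G. c x) = 0"
proof -
  have "(\<Sum>x\<in>carrier G. c x) = (\<Sum>x\<in>carrier G. c (g \<otimes> x))"
    using sum_left_translate[of "inv g" c] g by simp
  also have "\<dots> = c g * (\<Sum>x\<in>carrier G. c x)"
    by (simp add: linear_char_mult c g sum_distrib_left)
  finally show ?thesis using g by simp
qed

lemma group_char_group: "group (char_group G)"
proof (rule groupI)
  fix c assume c: "c \<in> carrier (char_group G)"
  have "(\<lambda>x\<in>carrier G. inverse (c x)) \<in> linear_chars G"
    using c unfolding char_group_def linear_chars_def by (auto simp: inverse_mult_distrib)
  moreover have "(\<lambda>x\<in>carrier G. (\<lambda>x\<in>carrier G. inverse (c x)) x * c x) = (\<lambda>x\<in>carrier G. 1)"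
    using c unfolding char_group_def linear_chars_def by (auto simp: restrict_def)
  ultimately show "\<exists>d\<in>carrier (char_group G). d \<otimes>\<^bsub>char_group G\<^esub> c = \<one>\<^bsub>char_group G\<^esub>"
    unfolding char_group_def by (intro bexI) auto
next
  fix c assume c: "c \<in> carrier (char_group G)"
  then show "\<one>\<^bsub>char_group G\<^esub> \<otimes>\<^bsub>char_group G\<^esub> c = c"
    unfolding char_group_def linear_chars_def by (auto simp: extensional_def restrict_def)
qed (auto simp: char_group_def linear_chars_def restrict_def extensional_def)

lemma char_group_pow:
  assumes "x \<in> carrier G"
  shows "(c [^]\<^bsub>char_group G\<^esub> (n::nat)) x = c x ^ n"
  by (induction n) (use assms in \<open>simp_all add: char_group_def nat_pow_def\<close>)

lemma linear_char_eq_one_iff: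
  assumes "c \<in> linear_chars G"
  shows "c = \<one>\<^bsub>char_group G\<^esub> \<longleftrightarrow> (\<forall>x\<in>carrier G. c x = 1)"
  using assms unfolding char_group_def linear_chars_def
  by (auto simp: restrict_def extensional_def fun_eq_iff)

text \<open>Two proper subgroups, here the kernels, do not cover the group: if neither
  \<open>a\<close> nor \<open>b\<close> avoids both kernels, then \<open>a b\<close> does.\<close>

lemma linear_chars_jointly_nontrivial:
  assumes "c \<in> linear_chars G" "d \<in> linear_chars G"
    and "a \<in> carrier G" "c a \<noteq> 1" "b \<in> carrier G" "d b \<noteq> 1"
  shows "\<exists>x\<in>carrier G. c x \<noteq> 1 \<and> d x \<noteq> 1"
proof (cases "c b = 1 \<and> d a = 1")
  case True
  then have "c (a \<otimes> b) \<noteq> 1" "d (a \<otimes> b) \<noteq> 1"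
    using assms by (simp_all add: linear_char_mult)
  then show ?thesis using assms by (intro bexI[of _ "a \<otimes> b"]) auto
next
  case False
  then show ?thesis using assms by blast
qed

text \<open>The count at \<open>x\<close> is the number of \<open>g\<close> with
  \<open>g x g^-1 \<in> D\<close>. After the sums are exchanged, conjugation by a fixed
  \<open>g\<close> permutes the group and preserves \<open>\<psi>\<close>, so every \<open>g\<close>
  contributes \<open>\<psi>(D)\<close>.\<close>

lemma sum_conj_count_linear_char:
  assumes fin: "finite (carrier G)" and sub: "D \<subseteq> carrier G" and \<psi>: "\<psi> \<in> linear_chars G"
  shows "(\<Sum>x\<in>carrier G. of_nat (card (centralizer_elt G x) * card (conj_class G x \<inter> D)) * \<psi> x)
    = of_nat (card (carrier G)) * char_sum \<psi> D"
proof -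
  have count: "of_nat (card (centralizer_elt G x) * card (conj_class G x \<inter> D))
      = (\<Sum>g\<in>carrier G. of_bool (g \<otimes> x \<otimes> inv g \<in> D) :: complex)"
    if "x \<in> carrier G" for x
    unfolding card_conjugators[OF fin that, symmetric] using fin by (simp add: Int_def)
  have "(\<Sum>x\<in>carrier G. of_nat (card (centralizer_elt G x) * card (conj_class G x \<inter> D)) * \<psi> x)
    = (\<Sum>x\<in>carrier G. \<Sum>g\<in>carrier G. of_bool (g \<otimes> x \<otimes> inv g \<in> D) * \<psi> x)"
    by (rule sum.cong[OF refl]) (simp only: count sum_distrib_right)
  also have "\<dots> = (\<Sum>g\<in>carrier G. \<Sum>x\<in>carrier G. of_bool (g \<otimes> x \<otimes> inv g \<in> D) * \<psi> x)"
    by (rule sum.swap)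
  also have "\<dots> = (\<Sum>g\<in>carrier G. \<Sum>x\<in>carrier G. of_bool (x \<in> D) * \<psi> x)"
  proof (rule sum.cong[OF refl])
    fix g assume g: "g \<in> carrier G"
    have cancel: "g \<otimes> (inv g \<otimes> x) = x" "inv g \<otimes> (g \<otimes> x) = x" if "x \<in> carrier G" for x
      using that g by (simp_all add: m_assoc[symmetric])
    show "(\<Sum>x\<in>carrier G. of_bool (g \<otimes> x \<otimes> inv g \<in> D) * \<psi> x)
      = (\<Sum>x\<in>carrier G. of_bool (x \<in> D) * \<psi> x)"
    proof (rule sum.reindex_bij_witness[of _ "\<lambda>y. inv g \<otimes> y \<otimes> g" "\<lambda>x. g \<otimes> x \<otimes> inv g"])
      fix x assume "x \<in> carrier G"
      then show "of_bool (g \<otimes> x \<otimes> inv g \<in> D) * \<psi> (g \<otimes> x \<otimes> inv g)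
          = of_bool (g \<otimes> x \<otimes> inv g \<in> D) * \<psi> x"
        using linear_char_conj[OF \<psi> g] by simp
    qed (use g in \<open>simp_all add: m_assoc cancel\<close>)
  qed
  also have "(\<Sum>x\<in>carrier G. of_bool (x \<in> D) * \<psi> x) = char_sum \<psi> D"
    unfolding char_sum_def using fin sub by (intro sum.mono_neutral_cong_right) auto
  finally show ?thesis by simp
qed

section \<open>Characters of prime power order\<close>

text \<open>\<open>c\<close> is 1 on every \<open>p ^ j\<close>-th power and constant on classes, so
  the class of \<open>a\<close> contains no such power once \<open>c a \<noteq> 1\<close>. The
  eigenvalue is selected by \<open>p\<close> alone, hence one \<open>\<theta>\<close> serves all
  such \<open>a\<close>.\<close>

lemma regular_PDS_prime_power_char:
  fixes \<theta>1 \<theta>2 :: int and p j :: nat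
  assumes D: "is_regular_PDS G D v k lam mu"
    and roots: "\<theta>1 + \<theta>2 = int lam - int mu" "\<theta>1 * \<theta>2 = int mu - int k"
    and p: "Factorial_Ring.prime p" "\<not> int p dvd \<theta>1 - \<theta>2"
    and c: "c \<in> linear_chars G" "\<And>x. x \<in> carrier G \<Longrightarrow> c x ^ (p ^ j) = 1"
  shows "\<exists>\<theta>\<in>{\<theta>1, \<theta>2}. \<forall>a\<in>carrier G. c a \<noteq> 1 \<longrightarrow>
    int (card (centralizer_elt G a) * card (conj_class G a \<inter> D)) = int k - \<theta>"
proof -
  note defs = D[unfolded is_regular_PDS_def is_PDS_def]
  have "v \<noteq> 0" using defs by (metis card_eq_0_iff empty_iff one_closed)
  moreover have "\<not> is_unit p" using p(1) not_prime_unit by blast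
  ultimately obtain v' where v': "v = p ^ multiplicity p v * v'" "\<not> p dvd v'"
    using multiplicity_decompose'[of v p] by blast
  define r where "r = multiplicity p v"
  have nopow: "x [^] (p ^ j) \<notin> conj_class G a" if "x \<in> carrier G" "a \<in> carrier G" "c a \<noteq> 1" for x a
  proof
    assume "x [^] (p ^ j) \<in> conj_class G a"
    then obtain g where "g \<in> carrier G" "x [^] (p ^ j) = g \<otimes> a \<otimes> inv g"
      unfolding conj_class_def by blast
    then have "c x ^ (p ^ j) = c a" using that c(1) by (metis linear_char_conj linear_char_pow)
    then show False using c(2) that by simp
  qed
  have prod: "(int k - \<theta>1) * (int k - \<theta>2) = int mu * int v"
  proof -
    have "(int k - \<theta>1) * (int k - \<theta>2) = int k * int k - (\<theta>1 + \<theta>2) * int k + \<theta>1 * \<theta>2"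
      by (simp add: algebra_simps)
    then show ?thesis unfolding roots using regular_PDS_card_identity[OF D] by simp
  qed
  have pr: "int p ^ r dvd (int k - \<theta>1) * (int k - \<theta>2)"
    unfolding prod using v'(1) unfolding r_def by (metis dvd_mult dvd_triv_left of_nat_mult of_nat_power)
  \<comment> \<open>The two factors differ by \<open>\<theta>1 - \<theta>2\<close>, so
    \<open>p\<close> divides at most one of them, and that one takes the whole of
    \<open>p ^ r\<close>.\<close>
  have "int p ^ r dvd int k - \<theta>1 \<or> int p ^ r dvd int k - \<theta>2"
  proof -
    have ip: "Factorial_Ring.prime (int p)" using p(1) by simp
    have "\<not> (int p dvd int k - \<theta>1 \<and> int p dvd int k - \<theta>2)"
      using p(2) dvd_diff[of "int p" "int k - \<theta>2" "int k - \<theta>1"] by auto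
    then have "coprime (int p ^ r) (int k - \<theta>1) \<or> coprime (int p ^ r) (int k - \<theta>2)"
      using prime_imp_coprime[OF ip] by (metis coprime_power_left_iff)
    then show ?thesis using pr coprime_dvd_mult_right_iff coprime_dvd_mult_left_iff by blast
  qed
  then obtain \<theta> \<theta>' where \<theta>: "{\<theta>, \<theta>'} = {\<theta>1, \<theta>2}" "int p ^ r dvd int k - \<theta>"
    "\<theta> + \<theta>' = int lam - int mu" "\<theta> * \<theta>' = int mu - int k" "\<not> int p dvd \<theta>' - \<theta>"
  proof (elim disjE, goal_cases)
    case 1
    then show ?case using roots p(2) dvd_diff_commute by blast
  next
    case 2
    then show ?case using 2(1)[of \<theta>2 \<theta>1] roots p(2) by (simp add: add.commute mult.commute insert_commute)
  qed
  obtain u where u: "int k - \<theta> = int p ^ r * u" using \<theta>(2) by (elim dvdE)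
  have "int (card (centralizer_elt G a) * card (conj_class G a \<inter> D)) = int k - \<theta>"
    if "a \<in> carrier G" "c a \<noteq> 1" for a
    using regular_PDS_conj_count[OF D \<theta>(3,4) p(1) \<theta>(5) v'(1)[folded r_def] v'(2) u] nopow that by blast
  then show ?thesis using \<theta>(1) by blast
qed

text \<open>Choose a prime \<open>p\<close> dividing the order \<open>m\<close> of the number
  \<open>c a\<close>, and let \<open>d\<close> be the power of \<open>c\<close> whose exponent
  \<open>n'\<close> is the part of \<open>ord c\<close> prime to \<open>p\<close>. Then
  \<open>d\<close> has p-power order, and \<open>d a \<noteq> 1\<close> because \<open>m\<close>
  does not divide \<open>n'\<close>.\<close>

lemma prime_power_char_separates:
  assumes fin: "finite (carrier G)" and H: "subgroup H (char_group G)"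
    and c: "c \<in> H" and a: "a \<in> carrier G" "c a \<noteq> 1"
  obtains p j :: nat and d where "Factorial_Ring.prime p" "p dvd group.ord (char_group G) c"
    "d \<in> H" "d a \<noteq> 1" "\<And>x. x \<in> carrier G \<Longrightarrow> d x ^ (p ^ j) = 1"
proof -
  interpret X: group "char_group G" by (rule group_char_group)
  define n where "n = X.ord c"
  have cX: "c \<in> carrier (char_group G)" using subgroup.mem_carrier[OF H c] .
  then have cl: "c \<in> linear_chars G" by (simp add: char_group_def)
  have cn: "c x ^ n = 1" if x: "x \<in> carrier G" for x
  proof -
    have "c x ^ n = (c [^]\<^bsub>char_group G\<^esub> n) x" using char_group_pow[OF x] by simp
    also have "\<dots> = \<one>\<^bsub>char_group G\<^esub> x" unfolding n_def using cX by simp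
    also have "\<dots> = 1" using x by (simp add: char_group_def)
    finally show ?thesis .
  qed
  \<comment> \<open>\<open>ord\<close> is 0 for elements of infinite order; this is excluded since
    the power of \<open>c\<close> to the group order is trivial.\<close>
  have n0: "n \<noteq> 0"
  proof -
    have "c [^]\<^bsub>char_group G\<^esub> Coset.order G \<in> linear_chars G"
      using X.nat_pow_closed[OF cX] by (simp add: char_group_def)
    moreover have "(c [^]\<^bsub>char_group G\<^esub> Coset.order G) x = 1" if x: "x \<in> carrier G" for x
      using char_group_pow[OF x] linear_char_pow[OF cl x, of "Coset.order G"] pow_order_eq_1[OF x]
        linear_char_one[OF cl] by simp
    ultimately have "c [^]\<^bsub>char_group G\<^esub> Coset.order G = \<one>\<^bsub>char_group G\<^esub>"
      by (simp add: linear_char_eq_one_iff)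
    then have "n dvd Coset.order G" unfolding n_def using X.pow_eq_id[OF cX] by simp
    then show ?thesis using fin order_gt_0_iff_finite by fastforce
  qed
  define m where "m = (LEAST m. 0 < m \<and> c a ^ m = 1)"
  have "0 < n \<and> c a ^ n = 1" using n0 cn[OF a(1)] by simp
  then have m: "0 < m" "c a ^ m = 1" unfolding m_def by (metis (mono_tags, lifting) LeastI)+
  have m_dvd: "m dvd i" if "c a ^ i = 1" for i
  proof -
    have "c a ^ (i mod m) = c a ^ (m * (i div m) + i mod m)"
      unfolding power_add power_mult by (simp add: m)
    then have "c a ^ (i mod m) = 1" using that by simp
    moreover have "i mod m < m" using m by simp
    ultimately have "\<not> 0 < i mod m"
      using not_less_Least[of "i mod m" "\<lambda>m. 0 < m \<and> c a ^ m = 1", folded m_def] by simp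
    then show ?thesis by auto
  qed
  have "m \<noteq> 1" using m a by auto
  then obtain p where p: "Factorial_Ring.prime p" "p dvd m" using prime_factor_nat by blast
  have pn: "p dvd n" using p m_dvd[OF cn[OF a(1)]] dvd_trans by blast
  have "\<not> is_unit p" using p(1) not_prime_unit by blast
  then obtain n' where n': "n = p ^ multiplicity p n * n'" "\<not> p dvd n'"
    using multiplicity_decompose'[of n p] n0 by blast
  define d where "d = c [^]\<^bsub>char_group G\<^esub> n'"
  have d: "d x = c x ^ n'" if "x \<in> carrier G" for x
    unfolding d_def using char_group_pow[OF that] .
  have "d \<in> H" unfolding d_def
    by (induction n') (use subgroup.one_closed[OF H] subgroup.m_closed[OF H _ c] in simp_all)
  moreover have "d a \<noteq> 1" unfolding d[OF a(1)] using m_dvd p(2) n'(2) dvd_trans by blast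
  moreover have "d x ^ (p ^ multiplicity p n) = 1" if "x \<in> carrier G" for x
    unfolding d[OF that] power_mult[symmetric]
    using cn[OF that] n'(1) by (simp add: mult.commute)
  ultimately show ?thesis using that p(1) pn unfolding n_def by blast
qed

end

section \<open>A single value of the count outside \<open>N\<close>, compared with
  \<open>\<xi>(D)\<close>\<close>

theorem mainTheorem9:
  fixes G :: "('a, 'b) monoid_scheme" and D :: "'a set" and v k lam mu :: nat
    and s :: int and H :: "('a \<Rightarrow> complex) set"
  assumes "group G" and "finite (carrier G)"
    and "is_regular_PDS G D v k lam mu"
    and "0 < mu" and "mu < k"
    and "s \<ge> 0" and "s ^ 2 = PDS_Delta k lam mu"
    and "subgroup H (char_group G)"
    and "H \<noteq> {\<one>\<^bsub>char_group G\<^esub>}"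
    and "\<forall>\<xi> \<in> H. coprime (group.ord (char_group G) \<xi>) (nat s)"
  shows "\<forall>a \<in> carrier G - {x \<in> carrier G. \<forall>\<xi> \<in> H. \<xi> x = 1}.
           \<forall>\<xi> \<in> H. \<xi> \<noteq> \<one>\<^bsub>char_group G\<^esub> \<longrightarrow>
             of_nat (card (centralizer_elt G a) * card (conj_class G a \<inter> D))
               = of_nat k - char_sum \<xi> D"
proof -
  interpret group G by fact
  note fin = \<open>finite (carrier G)\<close> and D = \<open>is_regular_PDS G D v k lam mu\<close>
    and H = \<open>subgroup H (char_group G)\<close>
  note defs = D[unfolded is_regular_PDS_def is_PDS_def]
  define N where "N = {x \<in> carrier G. \<forall>\<xi>\<in>H. \<xi> x = 1}"
  define \<Phi> where "\<Phi> = (\<lambda>a. card (centralizer_elt G a) * card (conj_class G a \<inter> D))"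
  have lin: "\<xi> \<in> linear_chars G" if "\<xi> \<in> H" for \<xi>
    using subgroup.mem_carrier[OF H that] by (simp add: char_group_def)

  define b where "b = int lam - int mu"
  have s2: "s\<^sup>2 = b\<^sup>2 + 4 * (int k - int mu)"
    using \<open>s ^ 2 = PDS_Delta k lam mu\<close> unfolding PDS_Delta_def b_def .
  have "s \<noteq> 0" using s2 \<open>mu < k\<close> by (auto simp: add_nonneg_eq_0_iff)
  have "even (b + s)"
  proof -
    have "even (s\<^sup>2) \<longleftrightarrow> even (b\<^sup>2)" unfolding s2 by simp
    then show ?thesis by simp
  qed
  \<comment> \<open>The eigenvalues are the roots \<open>(b + s) / 2\<close> and
    \<open>(b - s) / 2\<close> of X^2 - b X - (k - mu); parity makes them integers.\<close>
  then obtain \<theta>1 where \<theta>1: "b + s = 2 * \<theta>1" by (elim evenE)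
  define \<theta>2 where "\<theta>2 = \<theta>1 - s"
  have roots: "\<theta>1 + \<theta>2 = int lam - int mu" "\<theta>1 * \<theta>2 = int mu - int k"
  proof -
    show "\<theta>1 + \<theta>2 = int lam - int mu" using \<theta>1 unfolding \<theta>2_def b_def by simp
    have b: "b = 2 * \<theta>1 - s" using \<theta>1 by simp
    show "\<theta>1 * \<theta>2 = int mu - int k"
      using s2 unfolding b \<theta>2_def by (simp add: power2_eq_square algebra_simps)
  qed
  have diff: "\<theta>1 - \<theta>2 = s" by (simp add: \<theta>2_def)

  have local_value: "\<exists>\<eta>\<in>H. \<exists>\<theta>\<in>{\<theta>1, \<theta>2}. \<eta> a \<noteq> 1 \<and>
      (\<forall>x\<in>carrier G. \<eta> x \<noteq> 1 \<longrightarrow> int (\<Phi> x) = int k - \<theta>)"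
    if a: "a \<in> carrier G - N" for a
  proof -
    obtain \<xi> where \<xi>: "\<xi> \<in> H" "\<xi> a \<noteq> 1" using a unfolding N_def by blast
    obtain p j \<eta> where p: "Factorial_Ring.prime p" "p dvd group.ord (char_group G) \<xi>"
      and \<eta>: "\<eta> \<in> H" "\<eta> a \<noteq> 1" "\<And>x. x \<in> carrier G \<Longrightarrow> \<eta> x ^ (p ^ j) = 1"
      by (rule prime_power_char_separates[OF fin H \<xi>(1) _ \<xi>(2)]) (use a in auto)
    \<comment> \<open>\<open>p\<close> divides the order of an element of \<open>H\<close>, which is
      coprime to \<open>s\<close>, the difference of the eigenvalues.\<close>
    have "\<not> p dvd nat s"
      using assms(10) \<xi>(1) p by (metis coprime_common_divisor not_prime_unit)
    then have "\<not> int p dvd \<theta>1 - \<theta>2" unfolding diff 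
      using \<open>s \<ge> 0\<close> by (metis int_nat_eq of_nat_dvd_iff)
    from regular_PDS_prime_power_char[OF D roots p(1) this lin[OF \<eta>(1)] \<eta>(3)] \<eta>(1,2)
    show ?thesis unfolding \<Phi>_def by blast
  qed

  have global_value: "int (\<Phi> a) = int (\<Phi> b)" if ab: "a \<in> carrier G - N" "b \<in> carrier G - N" for a b
  proof -
    obtain \<eta> \<theta> where \<eta>: "\<eta> \<in> H" "\<eta> a \<noteq> 1"
      "\<And>x. x \<in> carrier G \<Longrightarrow> \<eta> x \<noteq> 1 \<Longrightarrow> int (\<Phi> x) = int k - \<theta>"
      using local_value[OF ab(1)] by blast
    obtain \<zeta> \<tau> where \<zeta>: "\<zeta> \<in> H" "\<zeta> b \<noteq> 1"
      "\<And>x. x \<in> carrier G \<Longrightarrow> \<zeta> x \<noteq> 1 \<Longrightarrow> int (\<Phi> x) = int k - \<tau>"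
      using local_value[OF ab(2)] by blast
    \<comment> \<open>At a point outside both kernels both formulas for \<open>\<Phi>\<close> hold,
      which forces \<open>\<theta> = \<tau>\<close>.\<close>
    have "\<exists>x\<in>carrier G. \<eta> x \<noteq> 1 \<and> \<zeta> x \<noteq> 1"
      using \<eta>(2) \<zeta>(2) ab linear_chars_jointly_nontrivial[OF lin[OF \<eta>(1)] lin[OF \<zeta>(1)]] by blast
    then have "\<theta> = \<tau>" using \<eta>(3) \<zeta>(3) by force
    then show ?thesis using \<eta> \<zeta> ab by simp
  qed

  have "of_nat (\<Phi> a) = of_nat k - char_sum \<xi> D"
    if a: "a \<in> carrier G - N" and \<xi>: "\<xi> \<in> H" "\<xi> \<noteq> \<one>\<^bsub>char_group G\<^esub>" for a \<xi>
  proof -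
    define t :: complex where "t = of_nat (\<Phi> a)"
    have twisted: "(\<Sum>x\<in>carrier G. of_nat (\<Phi> x) * \<psi> x) = of_nat v * char_sum \<psi> D"
      if "\<psi> \<in> linear_chars G" for \<psi>
      unfolding \<Phi>_def using sum_conj_count_linear_char[OF fin _ that, of D] defs by simp
    have "(\<Sum>x\<in>carrier G. of_nat (\<Phi> x)) = (of_nat v * of_nat k :: complex)"
    proof -
      have one: "(\<lambda>x\<in>carrier G. 1) \<in> linear_chars G" unfolding linear_chars_def by auto
      have "char_sum (\<lambda>x\<in>carrier G. 1) D = (\<Sum>x\<in>D. 1)"
        unfolding char_sum_def using defs by (intro sum.cong) auto
      then show ?thesis using twisted[OF one] defs by simp
    qed
    \<comment> \<open>On \<open>N\<close> the character is 1, and off \<open>N\<close> the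
      difference \<open>\<Phi> x - t\<close> is 0, so the weight \<open>\<xi>\<close> changes
      nothing. The two sides evaluate to \<open>v \<xi>(D)\<close> and
      \<open>v k - v t\<close>.\<close>
    moreover have "(\<Sum>x\<in>carrier G. (of_nat (\<Phi> x) - t) * \<xi> x) = (\<Sum>x\<in>carrier G. of_nat (\<Phi> x) - t)"
    proof (rule sum.cong[OF refl])
      fix x assume x: "x \<in> carrier G"
      show "(of_nat (\<Phi> x) - t) * \<xi> x = of_nat (\<Phi> x) - t"
      proof (cases "x \<in> N")
        case True
        then show ?thesis using \<xi>(1) unfolding N_def by simp
      next
        case False
        then show ?thesis using global_value[of x a] x a unfolding t_def by simp
      qed
    qed
    moreover have "(\<Sum>x\<in>carrier G. \<xi> x) = 0"
      using \<xi> lin sum_linear_char linear_char_eq_one_iff by blast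
    ultimately have "of_nat v * char_sum \<xi> D = of_nat v * (of_nat k - t)"
      using twisted[OF lin[OF \<xi>(1)]] defs
      by (simp add: left_diff_distrib right_diff_distrib sum_subtractf sum_distrib_left[symmetric])
    moreover have "v \<noteq> 0" using defs by (metis card_eq_0_iff empty_iff one_closed)
    ultimately show ?thesis unfolding t_def by simp
  qed
  then show ?thesis unfolding N_def \<Phi>_def by blast
qed

end
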